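(* Let $n\ge 1$, let $s\in\mathbb{C}$, let $(a_k)_{k\ge1}$ be complex numbers with $a_1=1$, let $L=\sum_{k=1}^{\infty}a_k k^{-s}$ be the corresponding formal Dirichlet series, and write its formal inverse as $L^{-1}=\sum_{k=1}^{\infty}b_k k^{-s}$. Let $D_n$ be the $n\times n$ matrix whose $(i,j)$ entry is $a_{j/i}$ if $i\mid j$ and $0$ otherwise, and let $W_n$ be the $n\times n$ matrix whose first column is $(0,w_2,\dots,w_n)^T$ with $w_k=k^{-s}$ for $2\le k\le n$, and whose other entries are zero. Let $A_n=W_n+D_n$ and $\tilde A_n=W_n+D_n^{-1}$. Then $$\det A_n=\sum_{k=1}^{n}\frac{b_k}{k^s}\qquad\text{and}\qquad \det\tilde A_n=\sum_{k=1}^{n}\frac{a_k}{k^s}.$$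
   Context: Formal Dirichlet series multiply by Dirichlet convolution of coefficients; a formal Dirichlet series with $a_1=1$ has a unique formal inverse, i.e. $b_1=1$ and $\sum_{d\mid m}a_d b_{m/d}=0$ for all $m>1$. The matrix $D_n$ is upper triangular with $1$'s on the diagonal, hence invertible. *)

theory Defs
  imports
    "HOL-Analysis.Complex_Transcendental"
    "Jordan_Normal_Form.Gauss_Jordan_Elimination"
    "Jordan_Normal_Form.Determinant"
begin

(* A formal Dirichlet series (sum over k >= 1 of a_k k^(-s)) is represented by its coefficient
   function a; the value a 0 carries no meaning and is never used below. *)

definition dirichlet_conv :: "(nat \<Rightarrow> complex) \<Rightarrow> (nat \<Rightarrow> complex) \<Rightarrow> nat \<Rightarrow> complex" where
  "dirichlet_conv a b m = (\<Sum>d | d dvd m. a d * b (m div d))"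

definition is_formal_inverse :: "(nat \<Rightarrow> complex) \<Rightarrow> (nat \<Rightarrow> complex) \<Rightarrow> bool" where
  "is_formal_inverse a b \<longleftrightarrow> (\<forall>m\<ge>1. dirichlet_conv a b m = (if m = 1 then 1 else 0))"

lemma dirichlet_conv_split:
  assumes "m \<ge> 1"
  shows "dirichlet_conv a b m = a 1 * b m + (\<Sum>d | d dvd m \<and> d \<noteq> 1. a d * b (m div d))"
proof -
  have fin: "finite {d. d dvd m}" using assms by (intro finite_divisors_nat) auto
  have "{d. d dvd m} - {1} = {d. d dvd m \<and> d \<noteq> 1}" by auto
  with sum.remove[OF fin, of 1 "\<lambda>d. a d * b (m div d)"] show ?thesis
    by (simp add: dirichlet_conv_def)
qed

lemma formal_inverse_unique:
  assumes a: "a 1 = 1" and b: "is_formal_inverse a b" and c: "is_formal_inverse a c" and "m \<ge> 1"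
  shows "b m = c m"
  using \<open>m \<ge> 1\<close>
proof (induction m rule: less_induct)
  case (less m)
  have "(\<Sum>d | d dvd m \<and> d \<noteq> 1. a d * b (m div d)) = (\<Sum>d | d dvd m \<and> d \<noteq> 1. a d * c (m div d))"
  proof (rule sum.cong[OF refl])
    fix d assume d: "d \<in> {d. d dvd m \<and> d \<noteq> 1}"
    then obtain e where e: "m = d * e" by auto
    with d less.prems have "d > 1" "e \<ge> 1" by (cases d; cases e; auto)+
    then have "m div d < m" "m div d \<ge> 1" using e by auto
    with less.IH show "a d * b (m div d) = a d * c (m div d)" by simp
  qed
  moreover have "dirichlet_conv a b m = dirichlet_conv a c m"
    using b c less.prems unfolding is_formal_inverse_def by auto
  ultimately show ?case
    using a by (simp add: dirichlet_conv_split[OF less.prems])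
qed

function formal_inverse_coeff :: "(nat \<Rightarrow> complex) \<Rightarrow> nat \<Rightarrow> complex" where
  "formal_inverse_coeff a m = (if m \<le> 1 then 1
     else - (\<Sum>d | d dvd m \<and> d \<noteq> 1. a d * formal_inverse_coeff a (m div d)))"
  by auto
termination
proof (relation "measure snd", goal_cases)
  case (2 a m d)
  then obtain e where e: "m = d * e" by auto
  with 2 have "d > 1" "e \<ge> 1" by (cases d; cases e; auto)+
  then show ?case using e by auto
qed auto

declare formal_inverse_coeff.simps [simp del]

lemma formal_inverse_exists:
  assumes "a 1 = 1"
  shows "is_formal_inverse a (formal_inverse_coeff a)"
  unfolding is_formal_inverse_def
proof (intro allI impI)
  fix m :: nat assume m: "m \<ge> 1"
  have "{d. d dvd Suc 0 \<and> d \<noteq> Suc 0} = {}" by auto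
  then show "dirichlet_conv a (formal_inverse_coeff a) m = (if m = 1 then 1 else 0)"
    using assms m formal_inverse_coeff.simps[of a m]
    by (auto simp: dirichlet_conv_split[OF m])
qed

(* The matrices are indexed from 0 here: position (i, j) holds the entry of row i + 1 and
   column j + 1. *)

definition D_mat :: "nat \<Rightarrow> (nat \<Rightarrow> complex) \<Rightarrow> complex mat" where
  "D_mat n a = Matrix.mat n n
     (\<lambda>(i, j). if (i + 1) dvd (j + 1) then a ((j + 1) div (i + 1)) else 0)"

definition W_mat :: "nat \<Rightarrow> complex \<Rightarrow> complex mat" where
  "W_mat n s = Matrix.mat n n
     (\<lambda>(i, j). if j = 0 \<and> i \<noteq> 0 then of_nat (i + 1) powr (- s) else 0)"

(* Hence mat_inverse (D_mat n a) is never None, and applying "the" to it is harmless. *)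
lemma mat_inverse_D_mat:
  assumes "a 1 = 1"
  obtains B where "mat_inverse (D_mat n a) = Some B" "B \<in> carrier_mat n n"
    "D_mat n a * B = 1\<^sub>m n" "B * D_mat n a = 1\<^sub>m n"
proof -
  have D: "D_mat n a \<in> carrier_mat n n" by (simp add: D_mat_def)
  have "upper_triangular (D_mat n a)"
    by (auto simp: D_mat_def upper_triangular_def dest: dvd_imp_le)
  then have "Determinant.det (D_mat n a) = prod_list (diag_mat (D_mat n a))"
    using D by (rule det_upper_triangular)
  also have "diag_mat (D_mat n a) = replicate n 1"
    using assms by (auto intro!: nth_equalityI simp: diag_mat_def D_mat_def)
  finally have "Determinant.det (D_mat n a) \<noteq> 0" by (simp add: prod_list_replicate)
  from det_non_zero_imp_unit[OF D this] mat_inverse(1)[OF D]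
  obtain B where B: "mat_inverse (D_mat n a) = Some B" by (meson not_None_eq)
  with mat_inverse(2)[OF D B] that show thesis by blast
qed

definition A_mat :: "nat \<Rightarrow> (nat \<Rightarrow> complex) \<Rightarrow> complex \<Rightarrow> complex mat" where
  "A_mat n a s = W_mat n s + D_mat n a"

definition A_tilde_mat :: "nat \<Rightarrow> (nat \<Rightarrow> complex) \<Rightarrow> complex \<Rightarrow> complex mat" where
  "A_tilde_mat n a s = W_mat n s + the (mat_inverse (D_mat n a))"

end

(* The map from a Dirichlet series to its matrix D_n is multiplicative, so D_n^(-1) is the matrix of
   the inverse series. Multiplying A_n on the left by this inverse, which has determinant 1, gives the
   identity plus a matrix supported in the first column. That product is lower triangular, and its
   corner entry is the sum of b_k k^(-s). The second formula is the first one for the inverse series. *)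

theory Submission
  imports Defs
begin

text \<open>The involution taking \<open>d\<close> to \<open>m div d\<close> on the divisors of
  \<open>m\<close> exchanges the two factors of each term.\<close>

lemma dirichlet_conv_commute:
  "dirichlet_conv a b m = dirichlet_conv b a m"
proof (cases "m = 0")
  case True
  \<comment> \<open>Every natural number divides 0, so both sums run over an infinite set and take
    the default value 0.\<close>
  then show ?thesis by (simp add: dirichlet_conv_def)
next
  case False
  show ?thesis
    unfolding dirichlet_conv_def
    by (rule sum.reindex_bij_witness[of _ "\<lambda>d. m div d" "\<lambda>d. m div d"])
      (use False in \<open>auto simp: div_dvd_iff_mult dvd_div_eq_mult mult.commute elim!: dvdE\<close>)
qed

lemma is_formal_inverse_sym:
  "is_formal_inverse a b \<Longrightarrow> is_formal_inverse b a"
  by (simp add: is_formal_inverse_def dirichlet_conv_commute)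

lemma formal_inverse_at_1:
  assumes "is_formal_inverse a b" "a 1 = 1"
  shows "b 1 = 1"
proof -
  have "{d::nat. d dvd Suc 0} = {Suc 0}" by auto
  moreover have "dirichlet_conv a b 1 = 1"
    using assms(1) by (simp add: is_formal_inverse_def)
  ultimately show ?thesis
    using assms(2) by (simp add: dirichlet_conv_def)
qed

lemma D_mat_carrier [simp]: "D_mat n a \<in> carrier_mat n n"
  by (simp add: D_mat_def)

lemma W_mat_carrier [simp]: "W_mat n s \<in> carrier_mat n n"
  by (simp add: W_mat_def)

lemma det_D_mat:
  assumes "a 1 = 1"
  shows "Determinant.det (D_mat n a) = 1"
proof -
  have "upper_triangular (D_mat n a)"
    by (auto simp: D_mat_def upper_triangular_def dest: dvd_imp_le)
  moreover have "diag_mat (D_mat n a) = replicate n 1"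
    using assms by (auto intro!: nth_equalityI simp: diag_mat_def D_mat_def)
  ultimately show ?thesis
    by (simp add: det_upper_triangular[OF _ D_mat_carrier] prod_list_replicate)
qed

text \<open>In 1-based indices, entry (i, j) of the product sums over the k with i dividing k and k
  dividing j. Writing k = i * d turns this into the convolution sum at j / i.\<close>

lemma D_mat_mult:
  "D_mat n a * D_mat n b = D_mat n (dirichlet_conv a b)"
proof (rule eq_matI)
  fix i j assume "i < dim_row (D_mat n (dirichlet_conv a b))" "j < dim_col (D_mat n (dirichlet_conv a b))"
  then have ij: "i < n" "j < n" by (auto simp: D_mat_def)
  \<comment> \<open>\<open>?f\<close> takes the 1-based summation index, while \<open>i\<close> and
    \<open>j\<close> stay 0-based.\<close>
  let ?f = "\<lambda>k. if Suc i dvd k \<and> k dvd Suc j then a (k div Suc i) * b (Suc j div k) else 0"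
  have "(D_mat n a * D_mat n b) $$ (i, j) = (\<Sum>k<n. ?f (Suc k))"
    using ij by (auto simp: D_mat_def scalar_prod_def atLeast0LessThan intro!: sum.cong)
  also have "\<dots> = sum ?f {1..n}"
    by (rule sum.reindex_bij_witness[of _ "\<lambda>k. k - 1" Suc]) auto
  also have "\<dots> = (\<Sum>k | Suc i dvd k \<and> k dvd Suc j. a (k div Suc i) * b (Suc j div k))"
  proof (rule sum.mono_neutral_cong_right)
    \<comment> \<open>Cutting the matrices off at size \<open>n\<close> loses no term, because every
      divisor of \<open>Suc j\<close> is at most \<open>n\<close>.\<close>
    show "{k. Suc i dvd k \<and> k dvd Suc j} \<subseteq> {1..n}"
    proof
      fix k assume "k \<in> {k. Suc i dvd k \<and> k dvd Suc j}"
      then have "0 < k" "k \<le> Suc j" by (auto dest: dvd_imp_le dvd_pos_nat[rotated])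
      with ij show "k \<in> {1..n}" by simp
    qed
  qed auto
  also have "\<dots> = (if Suc i dvd Suc j then dirichlet_conv a b (Suc j div Suc i) else 0)"
  proof (cases "Suc i dvd Suc j")
    case True
    then obtain q where q: "Suc j = Suc i * q" by (rule dvdE)
    show ?thesis
      unfolding dirichlet_conv_def q
      by (simp del: mult_Suc,
          rule sum.reindex_bij_witness[of _ "\<lambda>d. Suc i * d" "\<lambda>k. k div Suc i"])
        (auto simp del: mult_Suc)
  next
    case False
    then have empty: "{k. Suc i dvd k \<and> k dvd Suc j} = {}"
      by (auto dest: dvd_trans)
    show ?thesis unfolding empty using False by simp
  qed
  finally show "(D_mat n a * D_mat n b) $$ (i, j) = D_mat n (dirichlet_conv a b) $$ (i, j)"
    using ij by (simp add: D_mat_def)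
qed (auto simp: D_mat_def)

text \<open>By multiplicativity the product is the matrix of the unit series, whose coefficient at j
  / i is 1 for i = j and 0 for every larger multiple j of i.\<close>

lemma D_mat_formal_inverse:
  assumes "is_formal_inverse a b"
  shows "D_mat n a * D_mat n b = 1\<^sub>m n"
proof -
  have "dirichlet_conv a b (Suc j div Suc i) = (if i = j then 1 else 0)" if "Suc i dvd Suc j" for i j
  proof -
    from that obtain q where q: "Suc j = Suc i * q" by (rule dvdE)
    then have "q \<ge> 1" by (cases q) auto
    moreover have "q = 1 \<longleftrightarrow> i = j" using q by (metis mult.right_neutral mult_cancel_left nat.distinct(1) nat.inject)
    ultimately show ?thesis
      using assms unfolding is_formal_inverse_def q by (simp del: mult_Suc)
  qed
  moreover have "dirichlet_conv a b 1 = 1"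
    using assms by (simp add: is_formal_inverse_def)
  ultimately show ?thesis
    unfolding D_mat_mult by (auto intro!: eq_matI simp: D_mat_def)
qed

text \<open>Stated for an arbitrary inverse pair, so that it yields both determinants: once for
  \<open>a\<close> and \<open>b\<close>, once with the two exchanged.\<close>

lemma det_W_plus_D_mat:
  assumes "n \<ge> 1" "b 1 = 1" "is_formal_inverse a b"
  shows "Determinant.det (W_mat n s + D_mat n a) = (\<Sum>k = 1..n. b k / of_nat k powr s)"
proof -
  let ?M = "D_mat n b * (W_mat n s + D_mat n a)"
  \<comment> \<open>The inverse stands on the left here, so the inverse relation is needed with the
    two series exchanged.\<close>
  have M: "?M = D_mat n b * W_mat n s + 1\<^sub>m n"
    using D_mat_formal_inverse[OF is_formal_inverse_sym[OF assms(3)]]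
    by (simp add: mult_add_distrib_mat[OF D_mat_carrier W_mat_carrier D_mat_carrier])
  have carrier: "?M \<in> carrier_mat n n"
    by (intro mult_carrier_mat[of _ n n] add_carrier_mat) simp_all
  \<comment> \<open>\<open>W_mat\<close> vanishes outside its first column, so in the other columns
    only the identity matrix remains.\<close>
  have col: "?M $$ (i, j) = (if i = j then 1 else 0)" if "i < n" "j < n" "j \<noteq> 0" for i j
    using that unfolding M by (auto simp: D_mat_def W_mat_def scalar_prod_def intro!: sum.neutral)
  \<comment> \<open>As 1 divides every number, the top row of \<open>D_mat n b\<close> is b 1, ...,
    b n; it meets the first column of \<open>W_mat\<close>, whose top entry is 0.\<close>
  have "?M $$ (0, 0) = (\<Sum>k<n. b (Suc k) * (if k = 0 then 0 else of_nat (k + 1) powr (- s))) + 1"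
    using \<open>n \<ge> 1\<close> unfolding M
    by (auto simp: D_mat_def W_mat_def scalar_prod_def atLeast0LessThan intro!: sum.cong)
  \<comment> \<open>The 1 from the identity matrix is exactly the missing term at
    \<open>k = 0\<close>, since \<open>b 1 = 1\<close> and \<open>1 powr (- s) = 1\<close>.\<close>
  also have "\<dots> = (\<Sum>k<n. b (Suc k) * of_nat (Suc k) powr (- s))"
    using \<open>n \<ge> 1\<close> \<open>b 1 = 1\<close> by (cases n) (simp_all add: sum.lessThan_Suc_shift del: sum.lessThan_Suc)
  also have "\<dots> = (\<Sum>k = 1..n. b k / of_nat k powr s)"
    by (rule sum.reindex_bij_witness[of _ "\<lambda>k. k - 1" Suc]) (auto simp: powr_minus_divide)
  finally have corner: "?M $$ (0, 0) = (\<Sum>k = 1..n. b k / of_nat k powr s)" .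
  have "Determinant.det ?M = prod_list (diag_mat ?M)"
    by (rule det_lower_triangular[OF _ carrier]) (simp add: col)
  also have "\<dots> = (\<Prod>i<n. ?M $$ (i, i))"
    by (simp only: prod_list_diag_prod carrier_matD(1)[OF carrier] atLeast0LessThan)
  also have "\<dots> = ?M $$ (0, 0) * (\<Prod>i\<in>{..<n} - {0}. ?M $$ (i, i))"
    using \<open>n \<ge> 1\<close> by (intro prod.remove) auto
  also have "(\<Prod>i\<in>{..<n} - {0}. ?M $$ (i, i)) = 1"
    by (intro prod.neutral) (auto simp: col)
  finally have "Determinant.det ?M = (\<Sum>k = 1..n. b k / of_nat k powr s)"
    by (simp add: corner)
  moreover have "Determinant.det ?M = Determinant.det (D_mat n b) * Determinant.det (W_mat n s + D_mat n a)"
    by (rule det_mult[of _ n]) simp_all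
  ultimately show ?thesis
    using det_D_mat[of b n] \<open>b 1 = 1\<close> by simp
qed

text \<open>A left inverse and a right inverse of the same matrix coincide. This turns
  \<open>A_tilde_mat n a s\<close> into \<open>W_mat n s + D_mat n b\<close>.\<close>

lemma the_mat_inverse_D_mat:
  assumes "a 1 = 1" "is_formal_inverse a b"
  shows "the (mat_inverse (D_mat n a)) = D_mat n b"
proof -
  obtain B where B: "mat_inverse (D_mat n a) = Some B" "B \<in> carrier_mat n n"
    "B * D_mat n a = 1\<^sub>m n"
    using mat_inverse_D_mat[of a n, OF assms(1)] by metis
  have "B = B * (D_mat n a * D_mat n b)"
    using B D_mat_formal_inverse[OF assms(2)] by simp
  also have "\<dots> = (B * D_mat n a) * D_mat n b"
    by (rule assoc_mult_mat[symmetric, of _ n n _ n _ n]) (simp_all add: B)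
  also have "\<dots> = D_mat n b"
    by (simp add: B(3) left_mult_one_mat[OF D_mat_carrier])
  finally have "B = D_mat n b" .
  with B(1) show ?thesis by simp
qed

theorem corollary2p3:
  fixes n :: nat and s :: complex and a b :: "nat \<Rightarrow> complex"
  assumes "n \<ge> 1"
    and "a 1 = 1"
    and "is_formal_inverse a b"
  shows "Determinant.det (A_mat n a s) = (\<Sum>k = 1..n. b k / of_nat k powr s) \<and>
         Determinant.det (A_tilde_mat n a s) = (\<Sum>k = 1..n. a k / of_nat k powr s)"
  unfolding A_mat_def A_tilde_mat_def the_mat_inverse_D_mat[OF assms(2,3)]
  using det_W_plus_D_mat[OF assms(1) formal_inverse_at_1[OF assms(3,2)] assms(3)]
    det_W_plus_D_mat[OF assms(1,2) is_formal_inverse_sym[OF assms(3)]]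
  by simp

end
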